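(* The following two statements are equivalent: (a) There is a universal constant $K>0$ such that for any measurable set $E\subset[0,1]$ there is a finite partition $\{A_j\}_{j=1}^r$ of $\mathbb Z$ such that for every $j=1,\dots,r$ and every $f\in S(A_j)$ we have $\|P_Ef\|^2\le K|E|\|f\|^2$. (b) For every measurable $E\subset[0,1]$ and every $\epsilon>0$ there is a finite partition $\{A_j\}_{j=1}^r$ of $\mathbb Z$ such that for all $j=1,2,\dots,r$ and all $f\in S(A_j)$ $$(1-\epsilon)|E|\|f\|^2\le\|P_E(f)\|^2\le(1+\epsilon)|E|\|f\|^2 .$$
   Context: For $I\subset\mathbb Z$, $S(I)$ is the $L^2([0,1])$-closure of the linear span of $\{e^{2\pi i nt}\}_{n\in I}$. For measurable $E\subset[0,1]$, $|E|$ is its Lebesgue measure and $P_E$ is the orthogonal projection of $L^2[0,1]$ onto $L^2(E)$, i.e. $P_E(f)=f\cdot\chi_E$. Norms are $L^2[0,1]$ norms. *)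

theory Defs
  imports "HOL-Analysis.Analysis"
begin

text \<open>
  \<open>L\<^sup>2[0,1]\<close> is modelled by its representatives, complex-valued square-integrable functions with
  respect to Lebesgue measure on \<open>[0,1]\<close>. All notions below depend only on the values of a
  function almost everywhere on \<open>[0,1]\<close>, hence descend to the usual equivalence classes.
\<close>

definition L2 :: "(real \<Rightarrow> complex) set" where
  "L2 = {f \<in> borel_measurable (lebesgue_on {0..1}).
           integrable (lebesgue_on {0..1}) (\<lambda>t. (norm (f t))\<^sup>2)}"

definition L2_norm :: "(real \<Rightarrow> complex) \<Rightarrow> real" where
  "L2_norm f = sqrt (\<integral>t. (norm (f t))\<^sup>2 \<partial>lebesgue_on {0..1})"

definition expo :: "int \<Rightarrow> real \<Rightarrow> complex" where
  "expo n t = exp (2 * complex_of_real pi * \<i> * of_int n * complex_of_real t)"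

definition trig_span :: "int set \<Rightarrow> (real \<Rightarrow> complex) set" where
  "trig_span I = {(\<lambda>t. \<Sum>n\<in>F. c n * expo n t) | F c. finite F \<and> F \<subseteq> I}"

definition S :: "int set \<Rightarrow> (real \<Rightarrow> complex) set" where
  "S I = {f \<in> L2. \<forall>\<delta>>0. \<exists>g\<in>trig_span I. L2_norm (\<lambda>t. f t - g t) < \<delta>}"

definition proj :: "real set \<Rightarrow> (real \<Rightarrow> complex) \<Rightarrow> real \<Rightarrow> complex" where
  "proj E f = (\<lambda>t. f t * indicator E t)"

end

theory Submission
  imports Defs
begin

text \<open>
  The upper bound in (b) with \<open>\<epsilon> = 1\<close> is (a) with \<open>K = 2\<close>, so the content is that a
  one-sided bound with some constant self-improves to a two-sided bound with constants
  arbitrarily close to 1.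

  The reason is that unions of grid cells \<open>[k/N, (k+1)/N)\<close> with \<open>0 \<le> k < N\<close> satisfy (b) with no error at all.
  If all frequencies of \<open>f\<close> lie in one residue class modulo \<open>N\<close>, then \<open>\<bar>f\<bar>\<close> is
  \<open>1/N\<close>-periodic, every cell carries the same share of \<open>\<parallel>f\<parallel>\<^sup>2\<close>, and hence
  \<open>\<parallel>P\<^sub>J f\<parallel>\<^sup>2 = \<bar>J\<bar> \<parallel>f\<parallel>\<^sup>2\<close> for every union \<open>J\<close> of cells
  (\<open>S_grid_mass\<close>). A measurable set \<open>E\<close> agrees with such a \<open>J\<close> up to sets
  \<open>E - J\<close> and \<open>J - E\<close> of measure below any given \<open>\<delta>\<close> (\<open>grid_approximation\<close>).
  Now (a) is applied not to \<open>E\<close> but to these two sets: since \<open>K\<close> does not depend on the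
  set, on suitable partitions they contribute at most \<open>K\<delta> \<parallel>f\<parallel>\<^sup>2\<close> each. On a common
  refinement of both partitions and the residue classes modulo \<open>N\<close>, the quantity
  \<open>\<parallel>P\<^sub>E f\<parallel>\<^sup>2\<close> therefore differs from \<open>\<bar>E\<bar> \<parallel>f\<parallel>\<^sup>2\<close> by at most
  \<open>(K + 1)\<delta> \<parallel>f\<parallel>\<^sup>2\<close>, and \<open>\<delta> = \<epsilon>\<bar>E\<bar>/(K + 1)\<close> is the right choice when
  \<open>\<bar>E\<bar> > 0\<close>.
\<close>

section \<open>The norm of square-integrable functions\<close>

lemma L2_norm_nonneg: "0 \<le> L2_norm f"
  by (simp add: L2_norm_def)

lemma L2_norm_power2: "(L2_norm f)\<^sup>2 = (\<integral>t. (norm (f t))\<^sup>2 \<partial>lebesgue_on {0..1})"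
  by (simp add: L2_norm_def)

lemma L2_measurable: "f \<in> L2 \<Longrightarrow> f \<in> borel_measurable (lebesgue_on {0..1})"
  by (simp add: L2_def)

lemma L2_integrable: "f \<in> L2 \<Longrightarrow> integrable (lebesgue_on {0..1}) (\<lambda>t. (norm (f t))\<^sup>2)"
  by (simp add: L2_def)

text \<open>
  The cross term of the expanded square is split by the weighted inequality between the
  arithmetic and the geometric mean.
\<close>

lemma norm_add_power2_le:
  fixes x y :: "'a::real_normed_vector"
  assumes "\<eta> > 0"
  shows "(norm (x + y))\<^sup>2 \<le> (1 + \<eta>) * (norm x)\<^sup>2 + (1 + 1/\<eta>) * (norm y)\<^sup>2"
proof -
  have "(norm (x + y))\<^sup>2 \<le> (norm x + norm y)\<^sup>2"
    by (intro power_mono norm_triangle_ineq norm_ge_zero)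
  also have "\<dots> = (norm x)\<^sup>2 + (norm y)\<^sup>2 + 2 * (norm x * norm y)"
    by (simp add: power2_sum)
  also have "2 * (norm x * norm y) \<le> \<eta> * (norm x)\<^sup>2 + (norm y)\<^sup>2 / \<eta>"
  proof -
    have "\<eta> * (norm x)\<^sup>2 + (norm y)\<^sup>2 / \<eta> - 2 * (norm x * norm y) = (\<eta> * norm x - norm y)\<^sup>2 / \<eta>"
      using assms by (simp add: field_simps power2_eq_square)
    moreover have "\<dots> \<ge> 0"
      using assms by simp
    ultimately show ?thesis by linarith
  qed
  finally show ?thesis
    by (simp add: algebra_simps)
qed

lemma L2_add:
  assumes "f \<in> L2" "g \<in> L2"
  shows "(\<lambda>t. f t + g t) \<in> L2"
proof -
  note [measurable] = assms[THEN L2_measurable]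
  have "integrable (lebesgue_on {0..1}) (\<lambda>t. 2 * (norm (f t))\<^sup>2 + 2 * (norm (g t))\<^sup>2)"
    using assms[THEN L2_integrable] by auto
  then have "integrable (lebesgue_on {0..1}) (\<lambda>t. (norm (f t + g t))\<^sup>2)"
  proof (rule Bochner_Integration.integrable_bound)
    show "AE t in lebesgue_on {0..1}. norm ((norm (f t + g t))\<^sup>2)
            \<le> norm (2 * (norm (f t))\<^sup>2 + 2 * (norm (g t))\<^sup>2)"
      using norm_add_power2_le[of 1] by (intro AE_I2) simp
  qed measurable
  then show ?thesis
    by (simp add: L2_def)
qed

lemma L2_cmult:
  assumes "f \<in> L2"
  shows "(\<lambda>t. c * f t) \<in> L2"
  using L2_measurable[OF assms] L2_integrable[OF assms]
  by (simp add: L2_def norm_mult power_mult_distrib)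

lemma L2_diff: "f \<in> L2 \<Longrightarrow> g \<in> L2 \<Longrightarrow> (\<lambda>t. f t - g t) \<in> L2"
  using L2_add[OF _ L2_cmult[of g "-1"], of f] by simp

text \<open>
  Integrating the pointwise inequality and choosing the weight to be the quotient of the
  two norms gives Minkowski's inequality; enlarging both norms by \<open>e\<close> keeps that
  quotient meaningful when one of them vanishes.
\<close>

lemma L2_norm_triangle:
  assumes "f \<in> L2" "g \<in> L2"
  shows "L2_norm (\<lambda>t. f t + g t) \<le> L2_norm f + L2_norm g"
proof (rule field_le_epsilon)
  fix e :: real assume "e > 0"
  define a where "a = L2_norm f + e / 2"
  define b where "b = L2_norm g + e / 2"
  have pos: "a > 0" "b > 0"
    using \<open>e > 0\<close> L2_norm_nonneg[of f] L2_norm_nonneg[of g] by (auto simp: a_def b_def)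
  have "(L2_norm (\<lambda>t. f t + g t))\<^sup>2
      \<le> (\<integral>t. (1 + b/a) * (norm (f t))\<^sup>2 + (1 + 1/(b/a)) * (norm (g t))\<^sup>2 \<partial>lebesgue_on {0..1})"
    unfolding L2_norm_power2
    using L2_integrable[OF L2_add[OF assms]] assms[THEN L2_integrable] pos
    by (intro integral_mono norm_add_power2_le) auto
  also have "\<dots> = (1 + b/a) * (L2_norm f)\<^sup>2 + (1 + a/b) * (L2_norm g)\<^sup>2"
    using assms[THEN L2_integrable] by (simp add: L2_norm_power2)
  also have "\<dots> \<le> (1 + b/a) * a\<^sup>2 + (1 + a/b) * b\<^sup>2"
    using pos \<open>e > 0\<close> L2_norm_nonneg[of f] L2_norm_nonneg[of g]
    by (intro add_mono mult_left_mono power_mono) (auto simp: a_def b_def)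
  also have "\<dots> = (a + b)\<^sup>2"
    using pos by (simp add: field_simps power2_eq_square)
  finally have "L2_norm (\<lambda>t. f t + g t) \<le> a + b"
    by (rule power2_le_imp_le) (use pos in auto)
  then show "L2_norm (\<lambda>t. f t + g t) \<le> L2_norm f + L2_norm g + e"
    by (simp add: a_def b_def)
qed

lemma L2_norm_minus_commute: "L2_norm (\<lambda>t. f t - g t) = L2_norm (\<lambda>t. g t - f t)"
  by (simp add: L2_norm_def norm_minus_commute)

lemma abs_L2_norm_diff_le:
  assumes "f \<in> L2" "g \<in> L2"
  shows "\<bar>L2_norm f - L2_norm g\<bar> \<le> L2_norm (\<lambda>t. f t - g t)"
  using L2_norm_triangle[OF L2_diff[OF assms] assms(2)]
    L2_norm_triangle[OF L2_diff[OF assms(2,1)] assms(1)]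
  by (simp add: L2_norm_minus_commute[of g f])

lemma proj_measurable:
  assumes "E \<in> sets lebesgue" "f \<in> borel_measurable (lebesgue_on {0..1})"
  shows "proj E f \<in> borel_measurable (lebesgue_on {0..1})"
proof -
  have "indicator E \<in> borel_measurable lebesgue"
    using assms(1) by simp
  then have "(indicator E :: real \<Rightarrow> complex) \<in> borel_measurable (lebesgue_on {0..1})"
    by (rule measurable_restrict_space1)
  then show ?thesis
    using assms(2) by (simp add: proj_def)
qed

lemma norm_proj_power2: "(norm (proj E f t))\<^sup>2 = indicator E t * (norm (f t))\<^sup>2"
  by (simp add: proj_def indicator_def)

lemma proj_in_L2:
  assumes "E \<in> sets lebesgue" "f \<in> L2"
  shows "proj E f \<in> L2"
proof -
  note [measurable] = proj_measurable[OF assms(1) L2_measurable[OF assms(2)]]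
  from L2_integrable[OF assms(2)]
  have "integrable (lebesgue_on {0..1}) (\<lambda>t. (norm (proj E f t))\<^sup>2)"
  proof (rule Bochner_Integration.integrable_bound)
    show "AE t in lebesgue_on {0..1}. norm ((norm (proj E f t))\<^sup>2) \<le> norm ((norm (f t))\<^sup>2)"
      by (simp add: norm_proj_power2 indicator_def)
  qed measurable
  then show ?thesis
    by (simp add: L2_def)
qed

lemma L2_norm_proj_le:
  assumes "E \<in> sets lebesgue" "f \<in> L2"
  shows "L2_norm (proj E f) \<le> L2_norm f"
  unfolding L2_norm_def
  using L2_integrable[OF proj_in_L2[OF assms]] L2_integrable[OF assms(2)]
  by (intro real_sqrt_le_mono integral_mono) (auto simp: norm_proj_power2 indicator_def)

text \<open>
  Integrate \<open>\<chi>\<^sub>E + \<chi>\<^sub>J\<^sub>-\<^sub>E = \<chi>\<^sub>J + \<chi>\<^sub>E\<^sub>-\<^sub>J\<close> against \<open>\<bar>f\<bar>\<^sup>2\<close>.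
\<close>

lemma L2_norm_proj_exchange:
  assumes E: "E \<in> sets lebesgue" and J: "J \<in> sets lebesgue" and f: "f \<in> L2"
  shows "(L2_norm (proj E f))\<^sup>2 + (L2_norm (proj (J - E) f))\<^sup>2
       = (L2_norm (proj J f))\<^sup>2 + (L2_norm (proj (E - J) f))\<^sup>2"
proof -
  have int: "integrable (lebesgue_on {0..1}) (\<lambda>t. (norm (proj X f t))\<^sup>2)"
    if "X \<in> sets lebesgue" for X
    using L2_integrable[OF proj_in_L2[OF that f]] .
  have "(\<integral>t. (norm (proj E f t))\<^sup>2 + (norm (proj (J - E) f t))\<^sup>2 \<partial>lebesgue_on {0..1})
      = (\<integral>t. (norm (proj J f t))\<^sup>2 + (norm (proj (E - J) f t))\<^sup>2 \<partial>lebesgue_on {0..1})"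
    by (rule Bochner_Integration.integral_cong) (auto simp: norm_proj_power2 indicator_def)
  then show ?thesis
    using E J by (simp add: L2_norm_power2 int sets.Diff)
qed

section \<open>Trigonometric polynomials with frequencies in a residue class\<close>

lemma S_mono: "A \<subseteq> B \<Longrightarrow> S A \<subseteq> S B"
  unfolding S_def trig_span_def by fast

lemma trig_span_continuous:
  assumes "g \<in> trig_span I"
  shows "continuous_on UNIV g"
  using assms unfolding trig_span_def expo_def by (auto intro!: continuous_intros)

lemma trig_span_L2:
  assumes "g \<in> trig_span I"
  shows "g \<in> L2"
proof -
  have cont: "continuous_on {0..1} g"
    using trig_span_continuous[OF assms] continuous_on_subset by blast
  then have "integrable (lebesgue_on {0..1}) (\<lambda>t. (norm (g t))\<^sup>2)"
    by (intro continuous_imp_integrable_real continuous_intros)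
  moreover have "g \<in> borel_measurable (lebesgue_on {0..1})"
    using cont by (intro continuous_imp_measurable_on_sets_lebesgue) auto
  ultimately show ?thesis
    by (simp add: L2_def)
qed

text \<open>
  On a residue class \<open>m\<close> modulo \<open>N\<close>, the shift by \<open>1/N\<close> multiplies every exponential
  by the same unimodular number \<open>e\<^bsup>2\<pi>im/N\<^esup>\<close>.
\<close>

lemma norm_trig_span_shift:
  fixes N :: nat
  assumes N: "N > 0" and A: "\<And>n. n \<in> A \<Longrightarrow> n mod int N = m" and g: "g \<in> trig_span A"
  shows "norm (g (t + 1 / N)) = norm (g t)"
proof -
  obtain F c where F: "F \<subseteq> A" and g_eq: "g = (\<lambda>t. \<Sum>n\<in>F. c n * expo n t)"
    using g unfolding trig_span_def by auto
  have shift: "expo n (t + 1 / N) = expo m (1 / N) * expo n t" if "n \<in> F" for n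
  proof -
    define q where "q = n div int N"
    have "n mod int N = m"
      using A that F by blast
    then have n: "n = int N * q + m"
      using mult_div_mod_eq[of "int N" n] by (simp add: q_def)
    have "expo n (1 / N) = exp (2 * complex_of_real pi * \<i> * of_int m / of_nat N
                              + 2 * complex_of_real pi * \<i> * of_int q)"
      unfolding expo_def n using N by (intro arg_cong[of _ _ exp]) (simp add: field_simps)
    also have "\<dots> = expo m (1 / N) * exp (2 * of_int q * complex_of_real pi * \<i>)"
      by (simp add: exp_add expo_def mult_ac)
    also have "exp (2 * of_int q * complex_of_real pi * \<i>) = 1"
      using exp_integer_2pi[of "of_int q"] by simp
    finally have "expo n (1 / N) = expo m (1 / N)" by simp
    moreover have "expo n (t + 1 / N) = expo n (1 / N) * expo n t"
      by (simp add: expo_def algebra_simps flip: exp_add)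
    ultimately show ?thesis by simp
  qed
  have "g (t + 1 / N) = expo m (1 / N) * g t"
    unfolding g_eq sum_distrib_left by (rule sum.cong) (auto simp: shift)
  moreover have "norm (expo m (1 / N)) = 1"
    by (simp add: expo_def norm_exp_eq_Re)
  ultimately show ?thesis
    by (simp add: norm_mult)
qed

section \<open>Grid sets\<close>

definition grid :: "nat \<Rightarrow> nat set \<Rightarrow> real set" where
  "grid N M = (\<Union>k\<in>M. {real k / N..<(real k + 1) / N})"

lemma mem_grid_iff:
  assumes "N > 0"
  shows "t \<in> grid N M \<longleftrightarrow> (\<exists>k\<in>M. real k \<le> t * N \<and> t * N < real k + 1)"
  using assms by (simp add: grid_def field_simps)

lemma grid_borel: "grid N M \<in> sets borel"
  unfolding grid_def by (rule sets.countable_UN') (auto intro: countable_subset[OF subset_UNIV])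

lemma grid_full:
  assumes "N > 0"
  shows "grid N {..<N} = {0..<1}"
proof (intro set_eqI iffI)
  fix t assume "t \<in> grid N {..<N}"
  then obtain k where k: "k < N" "real k \<le> t * N" "t * N < real k + 1"
    using assms by (auto simp: mem_grid_iff)
  then have "0 \<le> t * N" "t * N < N" by linarith+
  then show "t \<in> {0..<1}"
    using assms by (auto simp: zero_le_mult_iff)
next
  fix t :: real assume t: "t \<in> {0..<1}"
  define k where "k = nat \<lfloor>t * N\<rfloor>"
  have k: "real k \<le> t * N" "t * N < real k + 1"
    using t by (simp_all add: k_def)
  have "t * N < N" using t assms by simp
  with k have "k < N" by linarith
  with k show "t \<in> grid N {..<N}"
    using assms by (auto simp: mem_grid_iff)
qed

text \<open>
  All cells of the grid carry the same integral of a \<open>1/N\<close>-periodic function, so only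
  the number of cells matters.
\<close>

lemma integral_grid_periodic:
  fixes h :: "real \<Rightarrow> real"
  assumes N: "N > 0" and M: "finite M" and cont: "continuous_on UNIV h"
    and per: "\<And>t. h (t + 1 / real N) = h t"
  shows "(\<integral>t. indicator (grid N M) t * h t \<partial>lborel)
       = card M * (\<integral>t. indicator {0..<1 / real N} t * h t \<partial>lborel)"
proof -
  define cell where "cell k = {real k / N..<(real k + 1) / N}" for k
  have int: "integrable lborel (\<lambda>t. indicator (cell k) t * h t)" for k
  proof -
    have "set_integrable lborel {real k / N..(real k + 1) / N} h"
      unfolding set_integrable_def
      by (intro borel_integrable_compact compact_Icc continuous_on_subset[OF cont]) auto
    then have "set_integrable lborel (cell k) h"
      by (rule set_integrable_subset) (auto simp: cell_def)
    then show ?thesis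
      by (simp add: set_integrable_def)
  qed
  have per': "h (t + real k / N) = h t" for t k
  proof (induction k)
    case (Suc k)
    have "t + real (Suc k) / N = (t + real k / N) + 1 / N"
      by (simp add: add_divide_distrib)
    with Suc per show ?case by metis
  qed simp
  have cell: "(\<integral>t. indicator (cell k) t * h t \<partial>lborel)
            = (\<integral>t. indicator {0..<1 / real N} t * h t \<partial>lborel)" for k
  proof -
    have "(\<integral>t. indicator (cell k) t * h t \<partial>lborel)
        = (\<integral>t. indicator (cell k) (real k / N + t) * h (real k / N + t) \<partial>lborel)"
      using lborel_integral_real_affine[of 1 "\<lambda>t. indicator (cell k) t * h t" "real k / N"] by simp
    also have "\<dots> = (\<integral>t. indicator {0..<1 / real N} t * h t \<partial>lborel)"
      using per'[of _ k]
      by (intro Bochner_Integration.integral_cong)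
         (auto simp: cell_def indicator_def add.commute add_divide_distrib)
    finally show ?thesis .
  qed
  have disj: "k = l" if "t \<in> cell k" "t \<in> cell l" for t k l
  proof -
    have "real k \<le> t * N" "t * N < real k + 1" "real l \<le> t * N" "t * N < real l + 1"
      using that N by (auto simp: cell_def field_simps)
    then show "k = l" by linarith
  qed
  have ind: "indicator (grid N M) t = (\<Sum>k\<in>M. indicator (cell k) t :: real)" for t
  proof -
    have "disjoint_family_on cell M"
      using disj by (auto simp: disjoint_family_on_def)
    then show ?thesis
      using M unfolding grid_def cell_def[symmetric]
      by (simp add: indicator_UN_disjoint)
  qed
  have "(\<integral>t. indicator (grid N M) t * h t \<partial>lborel)
      = (\<integral>t. (\<Sum>k\<in>M. indicator (cell k) t * h t) \<partial>lborel)"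
    by (simp add: ind sum_distrib_right)
  also have "\<dots> = card M * (\<integral>t. indicator {0..<1 / real N} t * h t \<partial>lborel)"
    by (simp add: int cell)
  finally show ?thesis .
qed

lemma measure_grid:
  assumes N: "N > 0" and M: "finite M"
  shows "measure lebesgue (grid N M) = card M / N"
  using integral_grid_periodic[OF N M, of "\<lambda>_. 1"] grid_borel[of N M] by simp

lemma L2_norm_proj_continuous:
  assumes "continuous_on UNIV g" and "X \<in> sets borel" and "X \<subseteq> {0..1}"
  shows "(L2_norm (proj X g))\<^sup>2 = (\<integral>t. indicator X t * (norm (g t))\<^sup>2 \<partial>lborel)"
proof -
  have [measurable]: "g \<in> borel_measurable borel"
    using assms(1) by (rule borel_measurable_continuous_onI)
  note [measurable] = assms(2)
  have "(L2_norm (proj X g))\<^sup>2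
      = (\<integral>t. indicator {0..1} t *\<^sub>R (indicator X t * (norm (g t))\<^sup>2) \<partial>lebesgue)"
    unfolding L2_norm_power2 norm_proj_power2 by (rule integral_restrict_space) simp
  also have "\<dots> = (\<integral>t. indicator X t * (norm (g t))\<^sup>2 \<partial>lebesgue)"
    using assms(3) by (intro Bochner_Integration.integral_cong) (auto simp: indicator_def)
  also have "\<dots> = (\<integral>t. indicator X t * (norm (g t))\<^sup>2 \<partial>lborel)"
    by (rule integral_completion) measurable
  finally show ?thesis .
qed

lemma L2_norm_proj_Ico:
  assumes "f \<in> L2"
  shows "L2_norm (proj {0..<1} f) = L2_norm f"
proof -
  have [measurable]: "proj {0..<1} f \<in> borel_measurable (lebesgue_on {0..1})"
    by (rule proj_measurable[OF _ L2_measurable[OF assms]]) simp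
  note [measurable] = L2_measurable[OF assms]
  have "{1::real} \<in> null_sets (lebesgue_on {0..1})"
    by (subst null_sets_restrict_space) auto
  then have "AE t in lebesgue_on {0..1}. t \<notin> {1::real}"
    by (rule AE_not_in)
  then have "AE t in lebesgue_on {0..1}. (norm (proj {0..<1} f t))\<^sup>2 = (norm (f t))\<^sup>2"
    using AE_space by eventually_elim (auto simp: proj_def)
  then have "(\<integral>t. (norm (proj {0..<1} f t))\<^sup>2 \<partial>lebesgue_on {0..1})
           = (\<integral>t. (norm (f t))\<^sup>2 \<partial>lebesgue_on {0..1})"
    by (intro integral_cong_AE) measurable
  then show ?thesis
    by (simp add: L2_norm_def)
qed

text \<open>
  Squeeze \<open>E\<close>, without the point 1 that no cell contains, between a compact set \<open>C\<close> and
  an open set \<open>U\<close>. Cells shorter than the distance from \<open>C\<close> to the complement of \<open>U\<close>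
  stay inside \<open>U\<close> as soon as they meet \<open>C\<close>, so the union of the cells that meet \<open>C\<close> lies
  between \<open>C\<close> and \<open>U\<close>.
\<close>

lemma grid_approximation:
  assumes E: "E \<in> sets lebesgue" "E \<subseteq> {0..1}" and "\<delta> > 0"
  obtains N M where "N > 0" "M \<subseteq> {..<N}"
    "measure lebesgue (E - grid N M) < \<delta>" "measure lebesgue (grid N M - E) < \<delta>"
proof -
  define E' where "E' = E - {1}"
  have E': "E' \<in> sets lebesgue" "E' \<subseteq> {0..<1}"
    using E by (auto simp: E'_def)
  obtain C where C: "closed C" "C \<subseteq> E'" "E' - C \<in> lmeasurable" "emeasure lebesgue (E' - C) < ennreal \<delta>"
    using sets_lebesgue_inner_closed[OF E'(1) \<open>\<delta> > 0\<close>] .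
  obtain U where U: "open U" "E' \<subseteq> U" "U - E' \<in> lmeasurable" "emeasure lebesgue (U - E') < ennreal \<delta>"
    using sets_lebesgue_outer_open[OF E'(1) \<open>\<delta> > 0\<close>] .
  have "bounded C"
    using C(2) E'(2) by (intro bounded_subset[of "{0..1::real}" C]) auto
  then have "compact C"
    using C(1) by (simp add: compact_eq_bounded_closed)
  then obtain e where e: "e > 0" "(\<Union>x\<in>C. ball x e) \<subseteq> U"
    using compact_subset_open_imp_ball_epsilon_subset[of C U] U(1,2) C(2) by blast
  obtain N where N: "N > 0" "1 / real N < e"
    using real_arch_inverse[of e] e(1) by (auto simp: inverse_eq_divide)
  define M where "M = {k. k < N \<and> grid N {k} \<inter> C \<noteq> {}}"
  have M: "M \<subseteq> {..<N}" by (auto simp: M_def)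
  have C_sub: "C \<subseteq> grid N M"
  proof
    fix t assume t: "t \<in> C"
    then have "t \<in> grid N {..<N}"
      unfolding grid_full[OF N(1)] using C(2) E'(2) by auto
    then obtain k where "k < N" "t \<in> grid N {k}"
      by (auto simp: grid_def)
    with t have "k \<in> M"
      by (auto simp: M_def)
    with \<open>t \<in> grid N {k}\<close> show "t \<in> grid N M"
      by (auto simp: grid_def)
  qed
  have sub_U: "grid N M \<subseteq> U"
  proof
    fix s assume "s \<in> grid N M"
    then obtain k where "k \<in> M" and s: "s \<in> grid N {k}"
      by (auto simp: grid_def)
    then obtain t where kt: "s \<in> grid N {k}" "t \<in> grid N {k}" "t \<in> C"
      by (auto simp: M_def)
    then have "\<bar>t - s\<bar> * N < 1"
      using N(1) by (auto simp: mem_grid_iff abs_if algebra_simps)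
    then have "\<bar>t - s\<bar> < 1 / N"
      using N(1) by (simp add: field_simps)
    then have "s \<in> ball t e"
      using N(2) by (simp add: dist_real_def)
    with e(2) kt(3) show "s \<in> U" by blast
  qed
  have grid_leb: "grid N M \<in> sets lebesgue"
    using grid_borel by simp
  have "grid N M \<subseteq> grid N {..<N}"
    using M by (auto simp: grid_def)
  then have "grid N M \<subseteq> {0..<1}"
    using grid_full[OF N(1)] by simp
  then have "grid N M - E \<subseteq> U - E'"
    using sub_U by (auto simp: E'_def)
  then have "measure lebesgue (grid N M - E) \<le> measure lebesgue (U - E')"
    using grid_leb E U(3) by (intro measure_mono_fmeasurable) auto
  also have "\<dots> < \<delta>"
    using U(3,4) \<open>\<delta> > 0\<close> by (simp add: emeasure_eq_measure2 ennreal_less_iff)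
  finally have *: "measure lebesgue (grid N M - E) < \<delta>" .
  have "E - grid N M \<subseteq> (E' - C) \<union> {1}"
    using C_sub by (auto simp: E'_def)
  then have "measure lebesgue (E - grid N M) \<le> measure lebesgue ((E' - C) \<union> {1})"
    using grid_leb E(1) C(3) by (intro measure_mono_fmeasurable fmeasurable.Un sets.Diff)
      (auto intro: fmeasurableI_null_sets)
  also have "\<dots> \<le> measure lebesgue (E' - C) + measure lebesgue {1::real}"
    using fmeasurableD[OF C(3)] by (intro measure_Un_le) auto
  also have "\<dots> < \<delta>"
    using C(3,4) \<open>\<delta> > 0\<close> by (simp add: emeasure_eq_measure2 ennreal_less_iff)
  finally show ?thesis
    using that N(1) M * by blast
qed

section \<open>Exact equidistribution of mass over grid sets\<close>

text \<open>
  With \<open>c\<close> the mass of one cell, the two sides are \<open>card M * c\<close> and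
  \<open>(card M / N) * (N * c)\<close>, because all \<open>N\<close> cells together cover the unit interval up to
  a null set.
\<close>

lemma trig_span_grid_mass:
  fixes N :: nat
  assumes N: "N > 0" and M: "M \<subseteq> {..<N}" and A: "\<And>n. n \<in> A \<Longrightarrow> n mod int N = m"
    and g: "g \<in> trig_span A"
  shows "(L2_norm (proj (grid N M) g))\<^sup>2 = measure lebesgue (grid N M) * (L2_norm g)\<^sup>2"
proof -
  define c where "c = (\<integral>t. indicator {0..<1 / real N} t * (norm (g t))\<^sup>2 \<partial>lborel)"
  have cont: "continuous_on UNIV g"
    using trig_span_continuous[OF g] .
  have mass: "(L2_norm (proj (grid N M') g))\<^sup>2 = card M' * c" if "M' \<subseteq> {..<N}" for M'
  proof -
    have "grid N M' \<subseteq> grid N {..<N}"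
      using that by (auto simp: grid_def)
    then have "grid N M' \<subseteq> {0..1}"
      using grid_full[OF N] by auto
    then show ?thesis
      using integral_grid_periodic[OF N, of M' "\<lambda>t. (norm (g t))\<^sup>2"]
        norm_trig_span_shift[OF N A g] cont that finite_subset[OF that]
      by (simp add: L2_norm_proj_continuous grid_borel c_def continuous_intros)
  qed
  have "(L2_norm g)\<^sup>2 = N * c"
    using mass[of "{..<N}"] grid_full[OF N] L2_norm_proj_Ico[OF trig_span_L2[OF g]] by simp
  then show ?thesis
    using mass[OF M] measure_grid[OF N finite_subset[OF M]] N by simp
qed

text \<open>
  Both sides of the identity are continuous in the \<open>L\<^sup>2\<close> norm, so it passes from
  trigonometric polynomials to their closure. Working with the norms instead of their squares
  makes both sides Lipschitz in \<open>f\<close>.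
\<close>

lemma S_grid_mass:
  fixes N :: nat
  assumes N: "N > 0" and M: "M \<subseteq> {..<N}" and A: "\<And>n. n \<in> A \<Longrightarrow> n mod int N = m"
    and f: "f \<in> S A"
  shows "(L2_norm (proj (grid N M) f))\<^sup>2 = measure lebesgue (grid N M) * (L2_norm f)\<^sup>2"
proof -
  define J where "J = grid N M"
  define s where "s = sqrt (measure lebesgue J)"
  have J: "J \<in> sets lebesgue"
    using grid_borel by (simp add: J_def)
  have fL: "f \<in> L2"
    using f by (simp add: S_def)
  have "\<bar>L2_norm (proj J f) - s * L2_norm f\<bar> \<le> 0"
  proof (rule field_le_epsilon)
    fix e :: real assume "e > 0"
    then have "e / (1 + s) > 0"
      by (simp add: s_def add_pos_nonneg)
    then obtain g where g: "g \<in> trig_span A" "L2_norm (\<lambda>t. f t - g t) < e / (1 + s)"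
      using f unfolding S_def by blast
    have gL: "g \<in> L2"
      using trig_span_L2[OF g(1)] .
    have "(L2_norm (proj J g))\<^sup>2 = (s * L2_norm g)\<^sup>2"
      using trig_span_grid_mass[OF N M A g(1)] by (simp add: J_def s_def power_mult_distrib)
    then have eq: "L2_norm (proj J g) = s * L2_norm g"
      by (rule power2_eq_imp_eq) (auto simp: L2_norm_nonneg s_def)
    have "\<bar>L2_norm (proj J f) - L2_norm (proj J g)\<bar> \<le> L2_norm (\<lambda>t. proj J f t - proj J g t)"
      by (intro abs_L2_norm_diff_le proj_in_L2 J fL gL)
    also have "(\<lambda>t. proj J f t - proj J g t) = proj J (\<lambda>t. f t - g t)"
      by (auto simp: proj_def algebra_simps)
    also have "L2_norm \<dots> \<le> L2_norm (\<lambda>t. f t - g t)"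
      by (intro L2_norm_proj_le J L2_diff fL gL)
    finally have 1: "\<bar>L2_norm (proj J f) - s * L2_norm g\<bar> \<le> L2_norm (\<lambda>t. f t - g t)"
      by (simp add: eq)
    have 2: "\<bar>s * L2_norm g - s * L2_norm f\<bar> \<le> s * L2_norm (\<lambda>t. f t - g t)"
      using mult_left_mono[OF abs_L2_norm_diff_le[OF fL gL], of s]
      by (simp add: s_def abs_mult abs_minus_commute flip: right_diff_distrib)
    have "\<bar>L2_norm (proj J f) - s * L2_norm f\<bar> \<le> (1 + s) * L2_norm (\<lambda>t. f t - g t)"
      using 1 2 by (simp add: algebra_simps)
    also have "\<dots> \<le> e"
      using g(2) \<open>e > 0\<close> by (simp add: s_def pos_less_divide_eq add_pos_nonneg mult.commute)
    finally show "\<bar>L2_norm (proj J f) - s * L2_norm f\<bar> \<le> 0 + e" by simp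
  qed
  then have "L2_norm (proj J f) = s * L2_norm f" by simp
  then show ?thesis
    by (simp add: s_def power_mult_distrib J_def)
qed

section \<open>Partitions and the equivalence\<close>

lemma partition_on_fibres: "partition_on UNIV (range (\<lambda>n. \<phi> -` {\<phi> n}))"
  by (rule partition_onI) (auto simp: disjnt_iff)

lemma finite_fibres:
  assumes "finite (range \<phi>)"
  shows "finite (range (\<lambda>n. \<phi> -` {\<phi> n}))"
proof -
  have "range (\<lambda>n. \<phi> -` {\<phi> n}) = (\<lambda>y. \<phi> -` {y}) ` range \<phi>" by auto
  with assms show ?thesis by simp
qed

text \<open>
  The refinement consists of the fibres of the map sending \<open>n\<close> to its cell in \<open>P\<close>, its
  cell in \<open>Q\<close> and its residue. Taking fibres over attained values only keeps out empty cells.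
\<close>

lemma common_refinement_mod:
  fixes P Q :: "int set set" and N :: nat
  assumes "finite P" "partition_on UNIV P" "finite Q" "partition_on UNIV Q" "N > 0"
  obtains R where "finite R" "partition_on UNIV R"
    "\<forall>A\<in>R. (\<exists>B\<in>P. A \<subseteq> B) \<and> (\<exists>B\<in>Q. A \<subseteq> B) \<and> (\<exists>m. \<forall>n\<in>A. n mod int N = m)"
proof -
  have "\<forall>n. \<exists>B\<in>P. n \<in> B" "\<forall>n. \<exists>B\<in>Q. n \<in> B"
    using assms(2,4) by (auto simp: partition_on_def)
  then obtain p q where p: "\<And>n. p n \<in> P" "\<And>n. n \<in> p n" and q: "\<And>n. q n \<in> Q" "\<And>n. n \<in> q n"
    by metis
  define \<phi> where "\<phi> n = (p n, q n, n mod int N)" for n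
  have "range \<phi> \<subseteq> P \<times> Q \<times> {0..<int N}"
    using p q assms(5) by (auto simp: \<phi>_def)
  then have "finite (range \<phi>)"
    using assms(1,3) by (meson finite_SigmaI finite_atLeastLessThan_int finite_subset)
  note fin = finite_fibres[OF this]
  show ?thesis
  proof (rule that[OF fin partition_on_fibres], intro ballI conjI)
    fix A assume "A \<in> range (\<lambda>n. \<phi> -` {\<phi> n})"
    then obtain a where "A = \<phi> -` {\<phi> a}" by auto
    then have A: "p n = p a" "q n = q a" "n mod int N = a mod int N" if "n \<in> A" for n
      using that by (auto simp: \<phi>_def)
    have "A \<subseteq> p a"
      using A(1) p(2) by blast
    then show "\<exists>B\<in>P. A \<subseteq> B"
      using p(1) by blast
    have "A \<subseteq> q a"
      using A(2) q(2) by blast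
    then show "\<exists>B\<in>Q. A \<subseteq> B"
      using q(1) by blast
    show "\<exists>m. \<forall>n\<in>A. n mod int N = m"
      using A(3) by blast
  qed
qed

text \<open>
  The self-improvement of the upper bound. The lower estimate comes from the loss on
  \<open>J - E\<close> and the upper one from the gain on \<open>E - J\<close>; each is at most
  \<open>K\<delta> \<parallel>f\<parallel>\<^sup>2\<close>, and replacing \<open>\<bar>J\<bar>\<close> by \<open>\<bar>E\<bar>\<close> costs another
  \<open>\<delta> \<parallel>f\<parallel>\<^sup>2\<close>.
\<close>

lemma two_sided_bound_of_upper_bound:
  fixes K \<epsilon> :: real
  assumes K: "K > 0"
    and upper: "\<And>E::real set. E \<in> sets lebesgue \<Longrightarrow> E \<subseteq> {0..1} \<Longrightarrow>
        \<exists>P::int set set. finite P \<and> partition_on UNIV P \<and>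
          (\<forall>A\<in>P. \<forall>f\<in>S A. (L2_norm (proj E f))\<^sup>2 \<le> K * measure lebesgue E * (L2_norm f)\<^sup>2)"
    and E: "E \<in> sets lebesgue" "E \<subseteq> {0..1}" and "\<epsilon> > 0"
  shows "\<exists>P::int set set. finite P \<and> partition_on UNIV P \<and>
        (\<forall>A\<in>P. \<forall>f\<in>S A.
          (1 - \<epsilon>) * measure lebesgue E * (L2_norm f)\<^sup>2 \<le> (L2_norm (proj E f))\<^sup>2 \<and>
          (L2_norm (proj E f))\<^sup>2 \<le> (1 + \<epsilon>) * measure lebesgue E * (L2_norm f)\<^sup>2)"
proof (cases "measure lebesgue E = 0")
  case True
  \<comment> \<open>Both bounds to be shown are 0, and so is the given upper bound.\<close>
  with upper[OF E] show ?thesis by simp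
next
  case False
  then have "measure lebesgue E > 0"
    by (simp add: less_le)
  define \<delta> where "\<delta> = \<epsilon> * measure lebesgue E / (K + 1)"
  have \<delta>: "\<delta> > 0" "(K + 1) * \<delta> = \<epsilon> * measure lebesgue E"
    using \<open>measure lebesgue E > 0\<close> K \<open>\<epsilon> > 0\<close> by (auto simp: \<delta>_def)
  obtain N M where N: "N > 0" and M: "M \<subseteq> {..<N}"
    and EJ: "measure lebesgue (E - grid N M) < \<delta>" and JE: "measure lebesgue (grid N M - E) < \<delta>"
    using grid_approximation[OF E \<delta>(1)] .
  define J where "J = grid N M"
  have "J \<subseteq> grid N {..<N}"
    using M by (auto simp: J_def grid_def)
  then have J: "J \<in> sets lebesgue" "J \<subseteq> {0..1}"
    using grid_full[OF N] grid_borel by (auto simp: J_def)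
  have lm: "E \<in> lmeasurable" "J \<in> lmeasurable"
    by (rule fmeasurableI2[of "{0..1}"]; use E J in simp)+
  have mEJ: "measure lebesgue E + measure lebesgue (J - E)
           = measure lebesgue J + measure lebesgue (E - J)"
    using measure_Un2[OF lm] measure_Un2[OF lm(2,1)] by (simp add: Un_commute)
  have sub: "E - J \<subseteq> {0..1}" "J - E \<subseteq> {0..1}"
    using E(2) J(2) by auto
  obtain P where P: "finite P" "partition_on UNIV P"
    "\<And>A f. A \<in> P \<Longrightarrow> f \<in> S A \<Longrightarrow>
      (L2_norm (proj (E - J) f))\<^sup>2 \<le> K * measure lebesgue (E - J) * (L2_norm f)\<^sup>2"
    using upper[OF sets.Diff[OF E(1) J(1)] sub(1)] by blast
  obtain Q where Q: "finite Q" "partition_on UNIV Q"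
    "\<And>A f. A \<in> Q \<Longrightarrow> f \<in> S A \<Longrightarrow>
      (L2_norm (proj (J - E) f))\<^sup>2 \<le> K * measure lebesgue (J - E) * (L2_norm f)\<^sup>2"
    using upper[OF sets.Diff[OF J(1) E(1)] sub(2)] by blast
  obtain R where R: "finite R" "partition_on UNIV R"
    "\<forall>A\<in>R. (\<exists>B\<in>P. A \<subseteq> B) \<and> (\<exists>B\<in>Q. A \<subseteq> B) \<and> (\<exists>m. \<forall>n\<in>A. n mod int N = m)"
    using common_refinement_mod[OF P(1,2) Q(1,2) N] .
  have "(1 - \<epsilon>) * measure lebesgue E * (L2_norm f)\<^sup>2 \<le> (L2_norm (proj E f))\<^sup>2 \<and>
        (L2_norm (proj E f))\<^sup>2 \<le> (1 + \<epsilon>) * measure lebesgue E * (L2_norm f)\<^sup>2"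
    if A: "A \<in> R" and f: "f \<in> S A" for A f
  proof -
    define w where "w = (L2_norm f)\<^sup>2"
    have w: "w \<ge> 0" by (simp add: w_def)
    have small: "K * measure lebesgue X * w \<le> K * \<delta> * w" if "measure lebesgue X < \<delta>" for X
      using that K w by (intro mult_right_mono mult_left_mono) auto
    obtain B where "B \<in> P" "A \<subseteq> B"
      using R(3) A by blast
    then have "(L2_norm (proj (E - J) f))\<^sup>2 \<le> K * measure lebesgue (E - J) * w"
      using P(3) f S_mono w_def by blast
    also have "\<dots> \<le> K * \<delta> * w"
      using small EJ by (simp add: J_def)
    finally have le1: "(L2_norm (proj (E - J) f))\<^sup>2 \<le> K * \<delta> * w" .
    obtain B where "B \<in> Q" "A \<subseteq> B"
      using R(3) A by blast
    then have "(L2_norm (proj (J - E) f))\<^sup>2 \<le> K * measure lebesgue (J - E) * w"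
      using Q(3) f S_mono w_def by blast
    also have "\<dots> \<le> K * \<delta> * w"
      using small JE by (simp add: J_def)
    finally have le2: "(L2_norm (proj (J - E) f))\<^sup>2 \<le> K * \<delta> * w" .
    obtain m where "\<forall>n\<in>A. n mod int N = m"
      using R(3) A by meson
    then have m: "n mod int N = m" if "n \<in> A" for n
      using that by simp
    have eq: "(L2_norm (proj J f))\<^sup>2 = measure lebesgue J * w"
      unfolding J_def w_def by (rule S_grid_mass[OF N M m f])
    have "f \<in> L2"
      using f by (simp add: S_def)
    note exch = L2_norm_proj_exchange[OF E(1) J(1) this]
    have "measure lebesgue E - \<delta> \<le> measure lebesgue J" "measure lebesgue J \<le> measure lebesgue E + \<delta>"
      using mEJ EJ JE measure_nonneg[of lebesgue "E - J"] measure_nonneg[of lebesgue "J - E"]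
      unfolding J_def[symmetric] by linarith+
    then have "(measure lebesgue E - \<delta>) * w \<le> measure lebesgue J * w"
      "measure lebesgue J * w \<le> (measure lebesgue E + \<delta>) * w"
      using w by (auto intro: mult_right_mono)
    moreover have "\<epsilon> * measure lebesgue E * w = K * \<delta> * w + \<delta> * w"
      unfolding \<delta>(2)[symmetric] by (simp add: algebra_simps)
    ultimately have "(1 - \<epsilon>) * measure lebesgue E * w \<le> (L2_norm (proj E f))\<^sup>2"
      "(L2_norm (proj E f))\<^sup>2 \<le> (1 + \<epsilon>) * measure lebesgue E * w"
      using exch eq le1 le2 zero_le_power2[of "L2_norm (proj (J - E) f)"]
        zero_le_power2[of "L2_norm (proj (E - J) f)"]
      unfolding left_diff_distrib distrib_right mult_1_left by linarith+
    then show ?thesis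
      by (simp add: w_def)
  qed
  with R(1,2) show ?thesis by blast
qed

theorem proposition6p7:
  "(\<exists>K::real. K > 0 \<and>
      (\<forall>E::real set. E \<in> sets lebesgue \<and> E \<subseteq> {0..1} \<longrightarrow>
        (\<exists>P::int set set. finite P \<and> partition_on UNIV P \<and>
          (\<forall>A\<in>P. \<forall>f\<in>S A.
            (L2_norm (proj E f))\<^sup>2 \<le> K * measure lebesgue E * (L2_norm f)\<^sup>2))))
   \<longleftrightarrow>
   (\<forall>E::real set. \<forall>\<epsilon>::real. E \<in> sets lebesgue \<and> E \<subseteq> {0..1} \<and> \<epsilon> > 0 \<longrightarrow>
      (\<exists>P::int set set. finite P \<and> partition_on UNIV P \<and>
        (\<forall>A\<in>P. \<forall>f\<in>S A.
          (1 - \<epsilon>) * measure lebesgue E * (L2_norm f)\<^sup>2 \<le> (L2_norm (proj E f))\<^sup>2 \<and>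
          (L2_norm (proj E f))\<^sup>2 \<le> (1 + \<epsilon>) * measure lebesgue E * (L2_norm f)\<^sup>2)))"
  (is "?a \<longleftrightarrow> ?b")
proof
  assume ?a
  then obtain K :: real where "K > 0" and upper:
    "\<forall>E::real set. E \<in> sets lebesgue \<and> E \<subseteq> {0..1} \<longrightarrow>
        (\<exists>P::int set set. finite P \<and> partition_on UNIV P \<and>
          (\<forall>A\<in>P. \<forall>f\<in>S A.
            (L2_norm (proj E f))\<^sup>2 \<le> K * measure lebesgue E * (L2_norm f)\<^sup>2))"
    by (elim exE conjE)
  show ?b
    by (intro allI impI, elim conjE)
      (rule two_sided_bound_of_upper_bound[OF \<open>K > 0\<close> upper[rule_format, OF conjI]])
next
  assume b: ?b
  show ?a
  proof (intro exI[of _ "2::real"] conjI allI impI)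
    fix E :: "real set" assume "E \<in> sets lebesgue \<and> E \<subseteq> {0..1}"
    with b[rule_format, of E 1]
    show "\<exists>P::int set set. finite P \<and> partition_on UNIV P \<and>
        (\<forall>A\<in>P. \<forall>f\<in>S A. (L2_norm (proj E f))\<^sup>2 \<le> 2 * measure lebesgue E * (L2_norm f)\<^sup>2)"
      by auto
  qed simp
qed

end
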